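(* Let $0<u_z<1$ and let $\mathcal F'=\{(x,y,z)\in\mathbb R^3 : z=xy,\ 0\le x\le 1,\ 0\le y\le 1,\ 0\le z\le u_z\}$. Then the volume (three-dimensional Lebesgue measure) of $\operatorname{conv}(\mathcal F')$ is $$\frac{u_z}{6}\left(3+2u_z\ln(u_z)-u_z-u_z^2\right).$$
   Context: $\operatorname{conv}$ denotes the convex hull in $\mathbb R^3$. *)

theory Defs
  imports "HOL-Analysis.Analysis"
begin

definition F' :: "real \<Rightarrow> (real ^ 3) set" where
  "F' u\<^sub>z = {p. p $ 3 = p $ 1 * p $ 2 \<and> 0 \<le> p $ 1 \<and> p $ 1 \<le> 1 \<and> 0 \<le> p $ 2 \<and> p $ 2 \<le> 1
                \<and> 0 \<le> p $ 3 \<and> p $ 3 \<le> u\<^sub>z}"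

end

theory Submission
  imports Defs
begin

text \<open>
  The hull is the body \<open>0 \<le> z \<le> u\<close>, \<open>z \<le> x\<close>, \<open>z \<le> y\<close>, \<open>x + y \<le> 1 + z\<close>, \<open>z\<^sup>2 \<le> u x y\<close>: its slice at
  height \<open>z = s u\<close> is the Minkowski combination of the triangle \<open>x, y \<ge> 0\<close>, \<open>x + y \<le> 1\<close> (weight \<open>1 - s\<close>)
  and the region between the hyperbola \<open>x y = u\<close> and its chord (weight \<open>s\<close>). A point of the body lies
  on a segment parallel to the y-axis. The upper end of this segment is on the chord from \<open>(z, 1, z)\<close> to
  \<open>(1, z, z)\<close>. Its lower end is on the segment from \<open>(s, z, z)\<close> to \<open>(1, z, z)\<close> if \<open>x \<ge> s\<close>, and otherwise
  on a segment from the origin to the hyperbola at height \<open>u\<close>. The volume then comes from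
  integrating the area of the slices.
\<close>

section \<open>The hull\<close>

definition hull_body :: "real \<Rightarrow> (real ^ 3) set" where
  "hull_body u = {p. 0 \<le> p $ 3 \<and> p $ 3 \<le> u \<and> p $ 3 \<le> p $ 1 \<and> p $ 3 \<le> p $ 2
      \<and> p $ 1 + p $ 2 \<le> 1 + p $ 3 \<and> (p $ 3)\<^sup>2 \<le> u * p $ 1 * p $ 2}"

text \<open>Once the square is expanded, the hypotheses bound every term except the mixed one in
  \<open>z * z'\<close>. That one is bounded by multiplying the two hypotheses and applying
  AM-GM.\<close>

lemma convex_rotated_cone:
  fixes u a b x y z x' y' z' :: real
  assumes "0 \<le> u" "0 \<le> x" "0 \<le> y" "0 \<le> x'" "0 \<le> y'" "0 \<le> a" "0 \<le> b"
    and "z\<^sup>2 \<le> u * x * y" "z'\<^sup>2 \<le> u * x' * y'"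
  shows "(a * z + b * z')\<^sup>2 \<le> u * (a * x + b * x') * (a * y + b * y')"
proof -
  have "(2 * (z * z'))\<^sup>2 = 4 * (z\<^sup>2 * z'\<^sup>2)"
    by (simp add: power_mult_distrib)
  also have "\<dots> \<le> 4 * ((u * x * y) * (u * x' * y'))"
    using assms by (intro mult_left_mono mult_mono) auto
  \<comment> \<open>With \<open>p = u * x * y'\<close> and \<open>q = u * x' * y\<close>, the added
    square completes \<open>4 * p * q\<close> to \<open>(p + q)^2\<close>.\<close>
  also have "\<dots> \<le> 4 * ((u * x * y) * (u * x' * y')) + (u * (x * y' - x' * y))\<^sup>2"
    by simp
  also have "\<dots> = (u * (x * y' + x' * y))\<^sup>2"
    by (simp add: power2_eq_square algebra_simps)
  finally have "2 * (z * z') \<le> u * (x * y' + x' * y)"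
    by (rule power2_le_imp_le) (use assms in auto)
  then have "a * b * (2 * (z * z')) \<le> a * b * (u * (x * y' + x' * y))"
    using assms by (intro mult_left_mono) auto
  moreover have "a\<^sup>2 * z\<^sup>2 \<le> a\<^sup>2 * (u * x * y)" "b\<^sup>2 * z'\<^sup>2 \<le> b\<^sup>2 * (u * x' * y')"
    using assms by (auto intro: mult_left_mono)
  ultimately show ?thesis
    by (simp add: power2_eq_square algebra_simps)
qed

lemma convex_hull_body:
  assumes "0 \<le> u"
  shows "convex (hull_body u)"
proof (rule convexI)
  fix p q :: "real ^ 3" and a b :: real
  assume p: "p \<in> hull_body u" and q: "q \<in> hull_body u" and a: "0 \<le> a" and b: "0 \<le> b" and ab: "a + b = 1"
  have conv: "a * s + b * t \<le> a * s' + b * t'" if "s \<le> s'" "t \<le> t'" for s t s' t' :: real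
    using that a b by (intro add_mono mult_left_mono)
  \<comment> \<open>The signs required by the cone inequality follow from \<open>0 \<le> z\<close>,
    \<open>z \<le> x\<close> and \<open>z \<le> y\<close>.\<close>
  have "0 \<le> p $ 1" "0 \<le> p $ 2" "0 \<le> q $ 1" "0 \<le> q $ 2"
    using p q by (auto simp: hull_body_def)
  then have "(a * p $ 3 + b * q $ 3)\<^sup>2
      \<le> u * (a * p $ 1 + b * q $ 1) * (a * p $ 2 + b * q $ 2)"
    using p q assms a b by (intro convex_rotated_cone) (auto simp: hull_body_def)
  moreover have "a * p $ 3 + b * q $ 3 \<le> a * u + b * u"
    using p q by (intro conv) (auto simp: hull_body_def)
  moreover have "a * u + b * u = u"
    using ab by (metis distrib_right mult_1)
  moreover have "a * (p $ 1 + p $ 2) + b * (q $ 1 + q $ 2) \<le> a * (1 + p $ 3) + b * (1 + q $ 3)"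
    using p q by (intro conv) (auto simp: hull_body_def)
  moreover have "0 \<le> a * p $ 3 + b * q $ 3"
    using p q a b by (auto simp: hull_body_def)
  moreover have "a * p $ 3 + b * q $ 3 \<le> a * p $ 1 + b * q $ 1"
      "a * p $ 3 + b * q $ 3 \<le> a * p $ 2 + b * q $ 2"
    using p q by (intro conv; auto simp: hull_body_def)+
  ultimately show "a *\<^sub>R p + b *\<^sub>R q \<in> hull_body u"
    using ab by (auto simp: hull_body_def distrib_left)
qed

text \<open>The linear bounds are the McCormick inequalities for the product \<open>x * y\<close> on
  the unit square; the quadratic one is \<open>z * z \<le> u * z\<close>.\<close>

lemma F'_subset_hull_body: "F' u \<subseteq> hull_body u"
proof
  fix p assume p: "p \<in> F' u"
  define x y where "x = p $ 1" and "y = p $ 2"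
  have xy: "0 \<le> x" "x \<le> 1" "0 \<le> y" "y \<le> 1" "x * y \<le> u" and z: "p $ 3 = x * y"
    using p by (auto simp: F'_def x_def y_def)
  have "0 \<le> (1 - x) * (1 - y)"
    using xy by simp
  then have "x + y \<le> 1 + x * y"
    by (simp add: algebra_simps)
  moreover have "(x * y) * (x * y) \<le> u * (x * y)"
    using xy by (intro mult_right_mono) auto
  moreover have "x * y \<le> x" "x * y \<le> y"
    using xy by (auto simp: mult_left_le mult_left_le_one_le)
  ultimately show "p \<in> hull_body u"
    using xy unfolding hull_body_def mem_Collect_eq z
    by (simp add: x_def[symmetric] y_def[symmetric] power2_eq_square mult.assoc)
qed

text \<open>With a base point and a direction, membership in a segment reduces to comparing
  parameters. The case \<open>s = t\<close> is separate because the weight divides by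
  \<open>t - s\<close>.\<close>

lemma convex_line_between:
  fixes p d :: "'a :: real_vector"
  assumes "convex C" "p + s *\<^sub>R d \<in> C" "p + t *\<^sub>R d \<in> C" "s \<le> r" "r \<le> t"
  shows "p + r *\<^sub>R d \<in> C"
proof (cases "s = t")
  case True
  then show ?thesis using assms by auto
next
  case False
  define w where "w = (r - s) / (t - s)"
  have w: "0 \<le> w" "w \<le> 1"
    using assms False by (auto simp: w_def)
  have "w * (t - s) = r - s"
    using False by (simp add: w_def)
  then have "r = (1 - w) * s + w * t"
    by (simp add: algebra_simps)
  then have r: "p + r *\<^sub>R d = (1 - w) *\<^sub>R (p + s *\<^sub>R d) + w *\<^sub>R (p + t *\<^sub>R d)"
    by (simp add: scaleR_add_left scaleR_add_right scaleR_diff_left)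
  then show ?thesis
    using convexD[OF assms(1-3), of "1 - w" w] w unfolding r by simp
qed

lemma vector_3_add_scaleR:
  fixes x y z a b c :: real
  shows "vector [x, y, z] + vector [a, b, c] = (vector [x + a, y + b, z + c] :: real ^ 3)"
    and "r *\<^sub>R vector [a, b, c] = (vector [r * a, r * b, r * c] :: real ^ 3)"
  by (simp_all add: vec_eq_iff forall_3)

lemma hull_body_subset_convex_hull:
  assumes u: "0 < u" "u < 1"
  shows "hull_body u \<subseteq> convex hull (F' u)"
proof
  fix p assume p: "p \<in> hull_body u"
  define C where "C = convex hull (F' u)"
  define x y z where "x = p $ 1" and "y = p $ 2" and "z = p $ 3"
  have pv: "p = vector [x, y, z]"
    by (simp add: vec_eq_iff forall_3 x_def y_def z_def)
  have h: "0 \<le> z" "z \<le> u" "z \<le> x" "z \<le> y" "x + y \<le> 1 + z" "z\<^sup>2 \<le> u * x * y"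
    using p by (auto simp: hull_body_def x_def y_def z_def)
  have convex: "convex C"
    by (simp add: C_def)
  have surface: "vector [a, b, a * b] \<in> C" if "0 \<le> a" "a \<le> 1" "0 \<le> b" "b \<le> 1" "a * b \<le> u" for a b
    unfolding C_def using that by (intro hull_inc) (simp add: F'_def)
  define s where "s = z / u"
  have s: "0 \<le> s" "s \<le> 1" "z = s * u"
    using h u by (auto simp: s_def)
  \<comment> \<open>The surface contains the origin, so surface points may be shrunk towards it by
    the factor \<open>s\<close>.\<close>
  have scaled: "vector [s * a, s * b, s * (a * b)] \<in> C"
    if "0 \<le> a" "a \<le> 1" "0 \<le> b" "b \<le> 1" "a * b \<le> u" for a b
    using convex_line_between[OF convex, of "vector [0, 0, 0]" 0 "vector [a, b, a * b]" 1 s]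
      surface[of 0 0] surface[OF that] s u by (simp add: vector_3_add_scaleR)
  \<comment> \<open>The parameters \<open>z\<close> and \<open>1\<close> give the chord's ends
    \<open>(z, 1, z)\<close> and \<open>(1, z, z)\<close>; \<open>x \<le> 1\<close> follows from
    \<open>x + y \<le> 1 + z\<close> and \<open>z \<le> y\<close>.\<close>
  have upper: "vector [x, 1 + z - x, z] \<in> C"
    using convex_line_between[OF convex, of "vector [0, 1 + z, z]" z "vector [1, -1, 0]" 1 x]
      surface[of 1 z] surface[of z 1] h u by (simp add: vector_3_add_scaleR)
  have lower: "\<exists>y' \<le> y. vector [x, y', z] \<in> C"
  proof (cases "x \<le> s")
    case False
    have "vector [s, z, z] \<in> C"
      using scaled[of 1 u] s u by simp
    then have "vector [x, z, z] \<in> C"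
      using convex_line_between[OF convex, of "vector [0, z, z]" s "vector [1, 0, 0]" 1 x]
        surface[of 1 z] h u False by (simp add: vector_3_add_scaleR)
    then show ?thesis using h by blast
  next
    case x: True
    show ?thesis
    proof (cases "s = 0")
      case True
      then have "x = 0" "z = 0" using h x s by auto
      then show ?thesis using surface[of 0 0] h u by auto
    next
      case False
      then have s0: "0 < s" using s by simp
      then have x0: "0 < x" using h s u by (metis less_le_trans mult_pos_pos)
      \<comment> \<open>The hyperbola point \<open>(a, u / a, u)\<close> scaled by \<open>s\<close>
        then has first coordinate \<open>x\<close> and height \<open>z\<close>;
        \<open>z \<le> x\<close> ensures \<open>u / a \<le> 1\<close>.\<close>
      define a where "a = x / s"
      have a: "0 < a" "a \<le> 1" "u \<le> a" "s * a = x"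
        using s0 x0 x h s by (auto simp: a_def field_simps)
      \<comment> \<open>This is the cone inequality with \<open>z = s * u\<close>, divided by
        \<open>u\<close>.\<close>
      have "s * s * u \<le> x * y"
        using h u unfolding s(3) by (simp add: power2_eq_square mult.assoc mult.left_commute[of _ u])
      then have "s * (u / a) \<le> y"
        using s0 x0 by (simp add: a_def field_simps)
      moreover have "vector [x, s * (u / a), z] \<in> C"
        using scaled[of a "u / a"] a s u by simp
      ultimately show ?thesis by blast
    qed
  qed
  then obtain y' where "y' \<le> y" "vector [x, y', z] \<in> C"
    by blast
  then show "p \<in> convex hull (F' u)"
    using convex_line_between[OF convex, of "vector [x, 0, z]" y' "vector [0, 1, 0]" "1 + z - x" y]
      upper h by (simp add: vector_3_add_scaleR pv C_def)
qed

lemma convex_hull_F':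
  assumes "0 < u" "u < 1"
  shows "convex hull (F' u) = hull_body u"
  using assms hull_body_subset_convex_hull F'_subset_hull_body convex_hull_body[of u]
  by (intro antisym hull_minimal) auto

section \<open>The volume of the hull\<close>

lemma measurable_vector_3 [measurable]:
  "(\<lambda>(z, x, y). vector [x, y, z] :: real ^ 3) \<in> borel_measurable borel"
proof -
  have "continuous_on UNIV (\<lambda>t. (\<chi> i. if i = 1 then fst (snd t) else if i = 2 then snd (snd t) else fst t) :: real ^ 3)"
  proof (rule continuous_on_vec_lambda)
    show "continuous_on UNIV (\<lambda>t. if i = 1 then fst (snd t) else if i = 2 then snd (snd t) else fst t)"
      for i :: 3
      by (cases "i = 1"; cases "i = 2") (simp_all add: continuous_intros)
  qed
  also have "(\<lambda>t. (\<chi> i. if i = 1 then fst (snd t) else if i = 2 then snd (snd t) else fst t) :: real ^ 3)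
      = (\<lambda>(z, x, y). vector [x, y, z])"
    by (auto simp: fun_eq_iff vec_eq_iff forall_3)
  finally show ?thesis
    by (rule borel_measurable_continuous_onI)
qed

lemma emeasure_lborel_Times:
  fixes A :: "'a :: euclidean_space set" and B :: "'b :: euclidean_space set"
  assumes "A \<in> sets borel" "B \<in> sets borel"
  shows "emeasure lborel (A \<times> B) = emeasure lborel A * emeasure lborel B"
proof -
  have "emeasure (lborel \<Otimes>\<^sub>M lborel) (A \<times> B) = emeasure lborel A * emeasure lborel B"
    using assms by (intro lborel.emeasure_pair_measure_Times) simp_all
  then show ?thesis
    by (simp only: lborel_prod)
qed

text \<open>It is enough to compare both measures on boxes, whose preimages are products of
  intervals. Listing \<open>z\<close> first makes it the outermost variable of integration.\<close>

lemma lborel_vector_3: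
  "(lborel :: (real ^ 3) measure) = distr lborel borel (\<lambda>(z, x, y). vector [x, y, z])"
proof (rule lborel_eqI)
  fix l u :: "real ^ 3"
  assume le: "\<And>b. b \<in> Basis \<Longrightarrow> l \<bullet> b \<le> u \<bullet> b"
  have lu: "l $ i \<le> u $ i" for i
    using le[of "axis i 1"] by (simp add: cart_eq_inner_axis)
  have "(\<lambda>(z, x, y). vector [x, y, z]) -` box l u
      = {l $ 3 <..< u $ 3} \<times> {l $ 1 <..< u $ 1} \<times> {l $ 2 <..< u $ 2}"
    by (auto simp: mem_box_cart forall_3)
  then have "emeasure (distr lborel borel (\<lambda>(z, x, y). vector [x, y, z])) (box l u)
      = emeasure lborel ({l $ 3 <..< u $ 3} \<times> {l $ 1 <..< u $ 1} \<times> {l $ 2 <..< u $ 2})"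
    by (simp add: emeasure_distr)
  also have "\<dots> = ennreal ((u $ 3 - l $ 3) * ((u $ 1 - l $ 1) * (u $ 2 - l $ 2)))"
    using lu by (simp add: emeasure_lborel_Times borel_Times ennreal_mult)
  also have "(u $ 3 - l $ 3) * ((u $ 1 - l $ 1) * (u $ 2 - l $ 2)) = (\<Prod>i\<in>UNIV. (u - l) $ i)"
    unfolding UNIV_3 by simp
  also have "\<dots> = (\<Prod>b\<in>Basis. (u - l) \<bullet> b)"
    by (simp add: Basis_vec_def cart_eq_inner_axis axis_eq_axis prod.UNION_disjoint)
  finally show "emeasure (distr lborel borel (\<lambda>(z, x, y). vector [x, y, z])) (box l u)
      = ennreal (\<Prod>b\<in>Basis. (u - l) \<bullet> b)" .
qed simp

lemma sets_hull_body: "hull_body u \<in> sets borel"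
  unfolding hull_body_def
  by (intro borel_closed closed_Collect_conj closed_Collect_le continuous_intros)

text \<open>Cavalieri's principle is applied twice, first to sections at fixed \<open>z\<close> and
  then to sections at fixed \<open>x\<close>.\<close>

lemma emeasure_hull_body_iterated:
  "emeasure lborel (hull_body u)
    = (\<integral>\<^sup>+z. \<integral>\<^sup>+x. emeasure lborel {y. vector [x, y, z] \<in> hull_body u} \<partial>lborel \<partial>lborel)"
proof -
  let ?V = "(\<lambda>(z, x, y). vector [x, y, z]) -` hull_body u :: (real \<times> real \<times> real) set"
  have V: "?V \<in> sets borel"
    using measurable_sets[OF measurable_vector_3 sets_hull_body] by simp
  have "emeasure lborel (hull_body u) = emeasure lborel ?V"
    by (subst lborel_vector_3) (simp add: emeasure_distr sets_hull_body)
  also have "\<dots> = emeasure (lborel \<Otimes>\<^sub>M lborel) ?V"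
    by (simp add: lborel_prod)
  also have "\<dots> = (\<integral>\<^sup>+z. emeasure lborel (Pair z -` ?V) \<partial>lborel)"
    by (rule lborel.emeasure_pair_measure_alt) (unfold lborel_prod, simp add: V)
  also have "\<dots> = (\<integral>\<^sup>+z. emeasure (lborel \<Otimes>\<^sub>M lborel) (Pair z -` ?V) \<partial>lborel)"
    by (simp add: lborel_prod)
  also have "\<dots> = (\<integral>\<^sup>+z. \<integral>\<^sup>+x. emeasure lborel (Pair x -` Pair z -` ?V) \<partial>lborel \<partial>lborel)"
  proof (intro nn_integral_cong lborel.emeasure_pair_measure_alt)
    fix z :: real
    have "?V \<in> sets (lborel \<Otimes>\<^sub>M (lborel \<Otimes>\<^sub>M lborel))"
      unfolding lborel_prod by (simp add: V)
    then show "Pair z -` ?V \<in> sets (lborel \<Otimes>\<^sub>M lborel)"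
      by (rule sets_Pair1)
  qed
  finally show ?thesis
    by (simp add: vimage_def)
qed

section \<open>Fibre lengths, slice areas and the volume\<close>

lemma fibre_nonneg:
  fixes u x z :: real
  assumes "0 < u" "0 < z" "z \<le> u" "x \<in> {z..1}"
  shows "0 \<le> 1 + z - x - max z (z\<^sup>2 / (u * x))"
proof -
  \<comment> \<open>Expanded, this says \<open>z \<le> x * (1 + z - x)\<close>; with
    \<open>z^2 \<le> u * z\<close> it puts the hyperbola branch below the chord.\<close>
  have "0 \<le> (x - z) * (1 - x)"
    using assms by simp
  then have "u * z \<le> u * (x * (1 + z - x))"
    using assms by (intro mult_left_mono) (auto simp: algebra_simps)
  moreover have "z\<^sup>2 \<le> u * z"
    using assms by (simp add: power2_eq_square)
  ultimately have "z\<^sup>2 \<le> (1 + z - x) * (u * x)"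
    by (simp add: algebra_simps)
  then have "z\<^sup>2 / (u * x) \<le> 1 + z - x"
    using assms by (subst pos_divide_le_eq) auto
  then show ?thesis
    using assms by simp
qed

lemma emeasure_hull_body_fibre:
  assumes u: "0 < u" and z: "0 < z" "z \<le> u"
  shows "emeasure lborel {y. vector [x, y, z] \<in> hull_body u}
    = ennreal (indicator {z..1} x * (1 + z - x - max z (z\<^sup>2 / (u * x))))"
proof -
  \<comment> \<open>For \<open>z \<le> x\<close> the product \<open>u * x\<close> is positive, so
    the cone inequality can be solved for \<open>y\<close>. For \<open>x > 1\<close> the interval is
    empty, in agreement with the indicator.\<close>
  have "{y. vector [x, y, z] \<in> hull_body u}
      = (if z \<le> x then {max z (z\<^sup>2 / (u * x)) .. 1 + z - x} else {})"
    using u z by (auto simp: hull_body_def field_simps)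
  then show ?thesis
    using fibre_nonneg[OF u z, of x] by (auto split: split_indicator)
qed

lemma has_integral_fibre:
  fixes u z :: real
  assumes u: "0 < u" "u < 1" and z: "0 < z" "z \<le> u"
  shows "((\<lambda>x. 1 + z - x - max z (z\<^sup>2 / (u * x))) has_integral
    ((1 - z\<^sup>2) / 2 + z\<^sup>2 * ln u / u - z + z\<^sup>2 / u)) {z..1}"
proof -
  let ?f = "\<lambda>x. 1 + z - x - max z (z\<^sup>2 / (u * x))"
  \<comment> \<open>The maximum switches branches at \<open>x = z / u\<close>.\<close>
  have s: "z \<le> z / u" "z / u \<le> 1"
    using mult_left_le[of u z] u z by (simp_all add: field_simps)
  let ?F = "\<lambda>x. (1 + z) * x - x\<^sup>2 / 2 - z\<^sup>2 / u * ln x"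
  have "((\<lambda>x. 1 + z - x - z\<^sup>2 / (u * x)) has_integral (?F (z / u) - ?F z)) {z..z / u}"
  proof (rule fundamental_theorem_of_calculus[OF s(1)])
    fix x assume "x \<in> {z..z / u}"
    then have "0 < x" using z by auto
    then have "(?F has_real_derivative (1 + z - x - z\<^sup>2 / (u * x))) (at x within {z..z / u})"
      using u by (auto intro!: derivative_eq_intros simp: field_simps)
    then show "(?F has_vector_derivative (1 + z - x - z\<^sup>2 / (u * x))) (at x within {z..z / u})"
      by (simp add: has_real_derivative_iff_has_vector_derivative)
  qed
  then have left: "(?f has_integral (?F (z / u) - ?F z)) {z..z / u}"
  proof (rule has_integral_eq[rotated])
    fix x assume x: "x \<in> {z..z / u}"
    then have "z * (u * x) \<le> z\<^sup>2"
      using u z by (auto simp: field_simps power2_eq_square)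
    then have "z \<le> z\<^sup>2 / (u * x)"
      using u z x by (simp add: field_simps)
    then show "1 + z - x - z\<^sup>2 / (u * x) = ?f x"
      by simp
  qed
  \<comment> \<open>On this branch the maximum is \<open>z\<close>, so the integrand collapses to
    \<open>1 - x\<close>.\<close>
  let ?G = "\<lambda>x::real. x - x\<^sup>2 / 2"
  have "((\<lambda>x. 1 - x) has_integral (?G 1 - ?G (z / u))) {z / u..1}"
  proof (rule fundamental_theorem_of_calculus[OF s(2)])
    fix x
    have "(?G has_real_derivative (1 - x)) (at x within {z / u..1})"
      by (auto intro!: derivative_eq_intros)
    then show "(?G has_vector_derivative (1 - x)) (at x within {z / u..1})"
      by (simp add: has_real_derivative_iff_has_vector_derivative)
  qed
  then have right: "(?f has_integral (?G 1 - ?G (z / u))) {z / u..1}"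
  proof (rule has_integral_eq[rotated])
    fix x assume x: "x \<in> {z / u..1}"
    moreover have "0 < z / u" using u z by simp
    ultimately have "0 < x" by (auto intro: less_le_trans)
    moreover have "z\<^sup>2 \<le> z * (u * x)"
      using u z x by (auto simp: field_simps power2_eq_square)
    ultimately have "z\<^sup>2 / (u * x) \<le> z"
      using u by (simp add: field_simps)
    then show "1 - x = ?f x"
      by simp
  qed
  \<comment> \<open>Since \<open>ln (z / u) - ln z = - ln u\<close>, no logarithm of
    \<open>z\<close> survives and the slice area is a polynomial in \<open>z\<close>.\<close>
  have "(?F (z / u) - ?F z) + (?G 1 - ?G (z / u))
      = (1 - z\<^sup>2) / 2 + z\<^sup>2 * ln u / u - z + z\<^sup>2 / u"
    using u z by (simp add: ln_div field_simps power2_eq_square)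
  then show ?thesis
    using has_integral_combine[OF s left right] by simp
qed

lemma measure_hull_body:
  assumes u: "0 < u" "u < 1"
  shows "measure lborel (hull_body u) = u / 6 * (3 + 2 * u * ln u - u - u ^ 2)" (is "_ = ?v")
proof -
  let ?A = "\<lambda>z. (1 - z\<^sup>2) / 2 + z\<^sup>2 * ln u / u - z + z\<^sup>2 / u"
  \<comment> \<open>For \<open>z > 0\<close> the area is the integral of a nonnegative fibre length;
    at \<open>z = 0\<close> it is \<open>1 / 2\<close>.\<close>
  have nonneg: "0 \<le> ?A z" if "z \<in> {0..u}" for z
  proof (cases "z = 0")
    case False
    then show ?thesis
      using u that by (intro has_integral_nonneg[OF has_integral_fibre fibre_nonneg]) auto
  qed simp
  let ?F = "\<lambda>z. (z - z ^ 3 / 3) / 2 + z ^ 3 / 3 * ln u / u - z\<^sup>2 / 2 + z ^ 3 / 3 / u"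
  have "(?A has_integral (?F u - ?F 0)) {0..u}"
  proof (rule fundamental_theorem_of_calculus)
    fix z
    have "(?F has_real_derivative ?A z) (at z within {0..u})"
      using u by (auto intro!: derivative_eq_intros simp: field_simps)
    then show "(?F has_vector_derivative ?A z) (at z within {0..u})"
      by (simp add: has_real_derivative_iff_has_vector_derivative)
  qed (use u in simp)
  also have "?F u - ?F 0 = ?v"
    using u by (simp add: field_simps power2_eq_square power3_eq_cube)
  finally have integral: "(?A has_integral ?v) {0..u}" .
  \<comment> \<open>The fibre formula was proved for \<open>z > 0\<close>; the excluded height
    \<open>z = 0\<close> is a null set.\<close>
  have "(\<integral>\<^sup>+x. emeasure lborel {y. vector [x, y, z] \<in> hull_body u} \<partial>lborel)
      = ennreal (indicator {0..u} z * ?A z)" if "z \<noteq> 0" for z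
  proof (cases "z \<in> {0..u}")
    case True
    then have z: "0 < z" "z \<le> u"
      using that by auto
    have "(\<integral>\<^sup>+x. emeasure lborel {y. vector [x, y, z] \<in> hull_body u} \<partial>lborel)
        = (\<integral>\<^sup>+x. ennreal (indicator {z..1} x * (1 + z - x - max z (z\<^sup>2 / (u * x)))) \<partial>lborel)"
      using u z by (simp add: emeasure_hull_body_fibre)
    also have "\<dots> = ennreal (?A z)"
      using u z by (intro nn_integral_has_integral_lebesgue fibre_nonneg has_integral_fibre)
    finally show ?thesis
      using True by simp
  next
    case False
    then have "{y. vector [x, y, z] \<in> hull_body u} = {}" for x
      by (auto simp: hull_body_def)
    then show ?thesis
      using False by simp
  qed
  then have "AE z in lborel. (\<integral>\<^sup>+x. emeasure lborel {y. vector [x, y, z] \<in> hull_body u} \<partial>lborel)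
      = ennreal (indicator {0..u} z * ?A z)"
    using AE_lborel_singleton[of "0 :: real"] by (auto elim: eventually_mono)
  then have "emeasure lborel (hull_body u) = (\<integral>\<^sup>+z. ennreal (indicator {0..u} z * ?A z) \<partial>lborel)"
    unfolding emeasure_hull_body_iterated by (rule nn_integral_cong_AE)
  also have "\<dots> = ennreal ?v"
    by (rule nn_integral_has_integral_lebesgue[OF nonneg integral])
  finally show ?thesis
    using has_integral_nonneg[OF integral nonneg] by (simp add: measure_def)
qed

theorem mainTheorem10:
  fixes u\<^sub>z :: real
  assumes "0 < u\<^sub>z" and "u\<^sub>z < 1"
  shows "measure lebesgue (convex hull (F' u\<^sub>z))
           = u\<^sub>z / 6 * (3 + 2 * u\<^sub>z * ln u\<^sub>z - u\<^sub>z - u\<^sub>z ^ 2)"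
proof -
  \<comment> \<open>Lebesgue measure is the completion of \<open>lborel\<close>, and the two agree
    on the Borel set \<open>hull_body\<close>.\<close>
  have "measure lebesgue (hull_body u\<^sub>z) = measure lborel (hull_body u\<^sub>z)"
    using sets_hull_body by (intro measure_completion) simp
  then show ?thesis
    using assms by (simp only: convex_hull_F' measure_hull_body)
qed

end
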